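(* Let $k$ be a positive integer and let $G$ be a graph with $\kappa'(G)\geq k$ and $\delta(G)\geq k+2$. Then $G$ contains an edge $e=uv$ such that $\kappa'(G-\{u,v\})\geq k$.
   Context: All graphs are finite, undirected, without loops or multiple edges. $\delta(G)$ is the minimum degree of $G$. For $S\subseteq V(G)$, $G-S$ denotes the subgraph of $G$ induced by $V(G)\setminus S$. The edge-connectivity $\kappa'(G)$ is the minimum size of an edge set $U\subseteq E(G)$ such that $G-U$ is disconnected; a graph is $k$-edge-connected if $\kappa'(G)\geq k$. By convention a trivial (one-vertex) graph is $1$-edge-connected but not $k$-edge-connected for any $k>1$. *)

theory Defs
  imports Main
begin

text \<open>A finite simple graph: finite vertex set V, edges are 2-element subsets of V.\<close>
definition graph :: "'a set \<Rightarrow> 'a set set \<Rightarrow> bool" where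
  "graph V E \<longleftrightarrow> finite V \<and> (\<forall>e\<in>E. e \<subseteq> V \<and> card e = 2)"

definition degree :: "'a set set \<Rightarrow> 'a \<Rightarrow> nat" where
  "degree E v = card {e\<in>E. v \<in> e}"

definition min_degree_ge :: "'a set \<Rightarrow> 'a set set \<Rightarrow> nat \<Rightarrow> bool" where
  "min_degree_ge V E d \<longleftrightarrow> (\<forall>v\<in>V. d \<le> degree E v)"

definition adj :: "'a set set \<Rightarrow> ('a \<times> 'a) set" where
  "adj E = {(x, y). {x, y} \<in> E}"

text \<open>Connected: nonempty and any two vertices joined by a walk.\<close>
definition connected_graph :: "'a set \<Rightarrow> 'a set set \<Rightarrow> bool" where
  "connected_graph V E \<longleftrightarrow> V \<noteq> {} \<and> (\<forall>x\<in>V. \<forall>y\<in>V. (x, y) \<in> (adj E)\<^sup>*)"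

text \<open>kappa'(G) >= k, with the convention that the trivial graph is 1- but not
  k-edge-connected for k > 1 (and k >= 1 is intended).\<close>
definition k_edge_connected :: "'a set \<Rightarrow> 'a set set \<Rightarrow> nat \<Rightarrow> bool" where
  "k_edge_connected V E k \<longleftrightarrow>
     V \<noteq> {} \<and> (card V = 1 \<longrightarrow> k \<le> 1) \<and>
     (\<forall>U. U \<subseteq> E \<and> card U < k \<longrightarrow> connected_graph V (E - U))"

text \<open>G - S: subgraph induced by V minus S.\<close>
definition del_verts_V :: "'a set \<Rightarrow> 'a set \<Rightarrow> 'a set" where
  "del_verts_V V S = V - S"

definition del_verts_E :: "'a set set \<Rightarrow> 'a set \<Rightarrow> 'a set set" where
  "del_verts_E E S = {e\<in>E. e \<inter> S = {}}"

end

theory Submission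
  imports Defs
begin

text \<open>
  Suppose that every edge \<open>uv\<close> is critical: \<open>G - {u, v}\<close> has a cut with fewer than \<open>k\<close> edges.
  Take such a minimum cut \<open>A\<close> of some \<open>G - {u, v}\<close> with \<open>|A|\<close> minimal.  Since degrees are at least
  \<open>k + 2\<close>, counting gives an edge \<open>xy\<close> of \<open>A\<close> none of whose ends has a neighbour beyond \<open>A\<close>, \<open>u\<close>
  and \<open>v\<close>.  Uncrossing a minimum cut \<open>C\<close> of \<open>G - {x, y}\<close> with \<open>A\<close> contradicts the minimality of \<open>A\<close>
  unless \<open>C\<close> separates \<open>u\<close> from \<open>v\<close>.  Choose \<open>xy\<close> and \<open>C\<close> with \<open>|A \<inter> C|\<close> minimal; the same counting
  gives an edge \<open>st\<close> deep inside \<open>A \<inter> C\<close>, and a minimum cut \<open>C'\<close> of \<open>G - {s, t}\<close> must separate both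
  \<open>u\<close> from \<open>v\<close> and \<open>x\<close> from \<open>y\<close>.  Of the eight cells cut out by \<open>A\<close>, \<open>C\<close> and \<open>C'\<close>, three that pairwise
  differ in two of the three cuts have boundaries adding up to at most
  \<open>3 (k - 1)\<close>, whereas each boundary has at least \<open>k\<close> edges.

  The last estimate needs that deleting a single vertex preserves \<open>k\<close>-edge-connectivity.  If this
  fails for some vertex \<open>z\<close>, let \<open>A\<close> be a smallest minimum cut over all such \<open>z\<close> and \<open>B\<close> its
  other side: vertices outside \<open>B\<close> without neighbours in \<open>B\<close> may be deleted
  safely, and the argument runs among these with cuts that do not split \<open>B\<close>.
\<close>

text \<open>Serves against least-cardinality choices: \<open>X\<close> loses all of \<open>T\<close>
  and can gain only the fewer vertices of \<open>S\<close>.\<close>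

lemma card_exchange_less:
  assumes "finite A" "T \<subseteq> A" "finite S" "X \<subseteq> (A - T) \<union> S" "card S < card T"
  shows "card X < card A"
proof -
  have "card X \<le> card ((A - T) \<union> S)" using assms by (intro card_mono) auto
  also have "\<dots> \<le> card (A - T) + card S" by (rule card_Un_le)
  also have "\<dots> < card A"
    using assms card_mono[OF assms(1,2)] finite_subset[OF assms(2,1)] by (simp add: card_Diff_subset)
  finally show ?thesis .
qed

section \<open>Cuts in vertex-deleted subgraphs\<close>

locale fin_graph =
  fixes V :: "'a set" and E :: "'a set set"
  assumes graph: "graph V E"
begin

text \<open>\<open>boundary S X\<close> and \<open>cut S X\<close> refer to \<open>G - S\<close>; they are meant for \<open>X \<subseteq> V - S\<close>.\<close>

definition boundary :: "'a set \<Rightarrow> 'a set \<Rightarrow> 'a set set" where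
  "boundary S X = {e \<in> E. e \<inter> S = {} \<and> e \<inter> X \<noteq> {} \<and> \<not> e \<subseteq> X}"

definition cut :: "'a set \<Rightarrow> 'a set \<Rightarrow> nat" where
  "cut S X = card (boundary S X)"

lemma finite_V: "finite V"
  using graph by (simp add: graph_def)

lemma finite_E: "finite E"
proof (rule finite_subset)
  show "E \<subseteq> Pow V" using graph by (auto simp: graph_def)
  show "finite (Pow V)" using finite_V by simp
qed

lemma edge_ends:
  assumes "{a, b} \<in> E"
  shows "a \<in> V" "b \<in> V" "a \<noteq> b"
  using assms graph by (auto simp: graph_def)

lemma edgeE:
  assumes "e \<in> E"
  obtains a b where "e = {a, b}" "{a, b} \<in> E" "a \<in> V" "b \<in> V" "a \<noteq> b"
proof -
  from assms graph have "card e = 2" by (auto simp: graph_def)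
  then obtain a b where e: "e = {a, b}" by (meson card_2_iff)
  show ?thesis using that[OF e] edge_ends assms e by auto
qed

lemma mem_boundary:
  "{a, b} \<in> boundary S X \<longleftrightarrow> {a, b} \<in> E \<and> a \<notin> S \<and> b \<notin> S \<and> (a \<in> X) \<noteq> (b \<in> X)"
  by (auto simp: boundary_def)

lemma finite_boundary: "finite (boundary S X)"
  using finite_E by (auto simp: boundary_def)

lemma cut_eq_sum: "cut S X = (\<Sum>e\<in>E. of_bool (e \<in> boundary S X))"
proof -
  have "boundary S X = E \<inter> {e. e \<in> boundary S X}" by (auto simp: boundary_def)
  then show ?thesis unfolding cut_def
    using finite_E by (simp add: of_bool_def sum.If_cases)
qed

lemma cut_mono:
  assumes "\<And>a b. \<lbrakk>{a, b} \<in> E; a \<in> V; b \<in> V; {a, b} \<in> boundary S X\<rbrakk> \<Longrightarrow> {a, b} \<in> boundary T Y"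
  shows "cut S X \<le> cut T Y"
  unfolding cut_def
proof (rule card_mono[OF finite_boundary], rule subsetI)
  fix e assume e: "e \<in> boundary S X"
  then have "e \<in> E" by (simp add: boundary_def)
  then show "e \<in> boundary T Y" using assms e by (metis edgeE)
qed

lemma cut_compl:
  assumes "S \<subseteq> V" "X \<subseteq> V - S"
  shows "cut S (V - S - X) = cut S X"
  by (rule antisym; rule cut_mono) (use assms in \<open>auto simp: mem_boundary\<close>)

text \<open>Restoring deleted vertices that have no neighbour in \<open>X\<close> adds no edge
  leaving \<open>X\<close>.\<close>

lemma cut_le_drop:
  assumes "S \<subseteq> T" "T \<inter> X = {}" "\<And>t x. \<lbrakk>t \<in> T - S; x \<in> X\<rbrakk> \<Longrightarrow> {t, x} \<notin> E"
  shows "cut S X \<le> cut T X"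
proof (rule cut_mono)
  fix a b assume "{a, b} \<in> E" "{a, b} \<in> boundary S X"
  then show "{a, b} \<in> boundary T X"
    using assms(1,2) assms(3)[of a b] assms(3)[of b a]
    by (auto simp: mem_boundary insert_commute)
qed

section \<open>Uncrossing inequalities\<close>

lemma cut_sum2_le:
  assumes "\<And>a b. \<lbrakk>{a, b} \<in> boundary S1 X1; a \<in> V; b \<in> V\<rbrakk> \<Longrightarrow>
      {a, b} \<in> boundary T1 Y1 \<or> {a, b} \<in> boundary T2 Y2"
    and "\<And>a b. \<lbrakk>{a, b} \<in> boundary S2 X2; a \<in> V; b \<in> V\<rbrakk> \<Longrightarrow>
      {a, b} \<in> boundary T1 Y1 \<or> {a, b} \<in> boundary T2 Y2"
    and "\<And>a b. \<lbrakk>{a, b} \<in> boundary S1 X1; {a, b} \<in> boundary S2 X2; a \<in> V; b \<in> V\<rbrakk> \<Longrightarrow>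
      {a, b} \<in> boundary T1 Y1 \<and> {a, b} \<in> boundary T2 Y2"
  shows "cut S1 X1 + cut S2 X2 \<le> cut T1 Y1 + cut T2 Y2"
proof -
  have "of_bool (e \<in> boundary S1 X1) + of_bool (e \<in> boundary S2 X2)
      \<le> of_bool (e \<in> boundary T1 Y1) + (of_bool (e \<in> boundary T2 Y2) :: nat)" if "e \<in> E" for e
  proof -
    from that obtain a b where e: "e = {a, b}" and ab: "{a, b} \<in> E" "a \<in> V" "b \<in> V"
      by (rule edgeE)
    show ?thesis
      unfolding e using assms(1)[OF _ ab(2,3)] assms(2)[OF _ ab(2,3)] assms(3)[OF _ _ ab(2,3)]
      by (cases "{a, b} \<in> boundary S1 X1"; cases "{a, b} \<in> boundary S2 X2"; auto)
  qed
  then show ?thesis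
    by (simp add: cut_eq_sum sum.distrib[symmetric] sum_mono)
qed

text \<open>As for two cuts, contributions are compared edge by edge, so only the positions of the
  two ends matter. The fourth hypothesis rules out an edge in all three left boundaries.\<close>

lemma cut_sum3_le:
  assumes "\<And>a b. \<lbrakk>{a, b} \<in> boundary S1 X1; a \<in> V; b \<in> V\<rbrakk> \<Longrightarrow>
      {a, b} \<in> boundary T1 Y1 \<or> {a, b} \<in> boundary T2 Y2 \<or> {a, b} \<in> boundary T3 Y3"
    and "\<And>a b. \<lbrakk>{a, b} \<in> boundary S2 X2; a \<in> V; b \<in> V\<rbrakk> \<Longrightarrow>
      {a, b} \<in> boundary T1 Y1 \<or> {a, b} \<in> boundary T2 Y2 \<or> {a, b} \<in> boundary T3 Y3"
    and "\<And>a b. \<lbrakk>{a, b} \<in> boundary S3 X3; a \<in> V; b \<in> V\<rbrakk> \<Longrightarrow>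
      {a, b} \<in> boundary T1 Y1 \<or> {a, b} \<in> boundary T2 Y2 \<or> {a, b} \<in> boundary T3 Y3"
    and "\<And>a b. \<lbrakk>{a, b} \<in> boundary S1 X1; {a, b} \<in> boundary S2 X2; a \<in> V; b \<in> V\<rbrakk> \<Longrightarrow>
      {a, b} \<in> boundary T1 Y1 \<and> {a, b} \<in> boundary T2 Y2 \<and> {a, b} \<notin> boundary S3 X3"
    and "\<And>a b. \<lbrakk>{a, b} \<in> boundary S1 X1; {a, b} \<in> boundary S3 X3; a \<in> V; b \<in> V\<rbrakk> \<Longrightarrow>
      {a, b} \<in> boundary T1 Y1 \<and> {a, b} \<in> boundary T3 Y3"
    and "\<And>a b. \<lbrakk>{a, b} \<in> boundary S2 X2; {a, b} \<in> boundary S3 X3; a \<in> V; b \<in> V\<rbrakk> \<Longrightarrow>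
      {a, b} \<in> boundary T2 Y2 \<and> {a, b} \<in> boundary T3 Y3"
  shows "cut S1 X1 + cut S2 X2 + cut S3 X3 \<le> cut T1 Y1 + cut T2 Y2 + cut T3 Y3"
proof -
  have "of_bool (e \<in> boundary S1 X1) + of_bool (e \<in> boundary S2 X2) + of_bool (e \<in> boundary S3 X3)
      \<le> of_bool (e \<in> boundary T1 Y1) + of_bool (e \<in> boundary T2 Y2)
       + (of_bool (e \<in> boundary T3 Y3) :: nat)" if "e \<in> E" for e
  proof -
    from that obtain a b where e: "e = {a, b}" and ab: "{a, b} \<in> E" "a \<in> V" "b \<in> V"
      by (rule edgeE)
    show ?thesis
      unfolding e using assms(1)[OF _ ab(2,3)] assms(2)[OF _ ab(2,3)] assms(3)[OF _ ab(2,3)]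
        assms(4)[OF _ _ ab(2,3)] assms(5)[OF _ _ ab(2,3)] assms(6)[OF _ _ ab(2,3)]
      by (cases "{a, b} \<in> boundary S1 X1"; cases "{a, b} \<in> boundary S2 X2";
          cases "{a, b} \<in> boundary S3 X3"; auto)
  qed
  then show ?thesis
    by (simp add: cut_eq_sum sum.distrib[symmetric] sum_mono)
qed

text \<open>Posimodularity of cuts, adapted to different deleted sets. Vertices of \<open>S\<close>
  outside \<open>T\<close> and \<open>C\<close> join the corner of \<open>A\<close>; their edges to
  vertices outside all four sets would be the only ones not paid for on the right, and
  \<open>noedge\<close> excludes them.\<close>

lemma uncross:
  assumes "S \<subseteq> V" "T \<subseteq> V" "A \<subseteq> V - S" "C \<subseteq> V - T" "T - S \<subseteq> A"
    and noedge: "\<And>s b. \<lbrakk>s \<in> S - T - C; b \<in> V - S - A - T - C\<rbrakk> \<Longrightarrow> {s, b} \<notin> E"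
  shows "cut T ((A \<union> S) - T - C) + cut S (C - S - A) \<le> cut S A + cut T C"
proof -
  have position: "(w \<in> A \<longrightarrow> w \<notin> S) \<and> (w \<in> C \<longrightarrow> w \<notin> T) \<and> (w \<in> T \<longrightarrow> w \<in> S \<or> w \<in> A)" for w
    using assms by blast
  have noedge': "{a, b} \<in> E \<and> a \<in> V \<and> b \<in> V \<longrightarrow>
      \<not> (a \<in> S \<and> a \<notin> T \<and> a \<notin> C \<and> b \<notin> S \<and> b \<notin> A \<and> b \<notin> T \<and> b \<notin> C) \<and>
      \<not> (b \<in> S \<and> b \<notin> T \<and> b \<notin> C \<and> a \<notin> S \<and> a \<notin> A \<and> a \<notin> T \<and> a \<notin> C)" for a b
    using noedge[of a b] noedge[of b a] by (auto simp: insert_commute)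
  show ?thesis
    apply (rule cut_sum2_le; unfold mem_boundary Un_iff Diff_iff)
    subgoal for a b using position[of a] position[of b] noedge'[of a b] by sat
    subgoal for a b using position[of a] position[of b] noedge'[of a b] by sat
    subgoal for a b using position[of a] position[of b] noedge'[of a b] by sat
    done
qed

text \<open>Opposite corners. Edges from the far corner to \<open>x\<close> or \<open>y\<close>
  cross \<open>A\<close> and those to \<open>u\<close> cross \<open>C\<close>, so only
  \<open>v\<close> stays deleted there. Edges from \<open>A \<inter> C\<close> to \<open>u\<close>,
  \<open>x\<close> or \<open>y\<close> are paid for by neither cut.\<close>

lemma cut_diagonal:
  assumes "A \<subseteq> V - {u, v}" "C \<subseteq> V - {x, y}" "x \<in> A" "y \<in> A" "u \<in> C" "v \<notin> C"
  shows "cut {v} (V - A - {u, v} - C) + cut {u, x, y} (A \<inter> C) \<le> cut {u, v} A + cut {x, y} C"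
proof -
  have position: "(w \<in> A \<longrightarrow> w \<noteq> u \<and> w \<noteq> v) \<and> (w \<in> C \<longrightarrow> w \<noteq> x \<and> w \<noteq> y)
      \<and> (w = x \<longrightarrow> w \<in> A) \<and> (w = y \<longrightarrow> w \<in> A) \<and> (w = u \<longrightarrow> w \<in> C) \<and> (w = v \<longrightarrow> w \<notin> C)" for w
    using assms by blast
  show ?thesis
    apply (rule cut_sum2_le; unfold mem_boundary Int_iff Diff_iff insert_iff empty_iff)
    subgoal for a b using position[of a] position[of b] by sat
    subgoal for a b using position[of a] position[of b] by sat
    subgoal for a b using position[of a] position[of b] by sat
    done
qed

text \<open>Two cells differing in two of the three cuts are joined only by edges counted twice on the
  right, and every other edge leaving a cell crosses at least one cut.\<close>

lemma three_cuts:
  assumes "A \<subseteq> V - {u, v}" "C \<subseteq> V - {x, y}" "C' \<subseteq> V - {s, t}"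
    and "x \<in> A" "y \<in> A" "s \<in> A" "t \<in> A" "s \<in> C" "t \<in> C"
    and "u \<in> C" "v \<notin> C" "u \<in> C'" "v \<notin> C'" "x \<in> C'" "y \<notin> C'"
  shows "cut {x} ((A \<inter> C') - {x, y} - C) + cut {u} (C \<inter> C' - A - {u, v})
           + cut {v} (V - A - {u, v} - C - C')
         \<le> cut {u, v} A + cut {x, y} C + cut {s, t} C'" (is ?first)
    and "cut {v, y} (A - {x, y} - C - {s, t} - C') + cut {} (C - A - {u, v} - C')
           + cut {} (C' - A - {u, v} - C)
         \<le> cut {u, v} A + cut {x, y} C + cut {s, t} C'" (is ?second)
proof -
  have position: "(w \<in> A \<longrightarrow> w \<noteq> u \<and> w \<noteq> v) \<and> (w \<in> C \<longrightarrow> w \<noteq> x \<and> w \<noteq> y) \<and> (w \<in> C' \<longrightarrow> w \<noteq> s \<and> w \<noteq> t)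
      \<and> (w = x \<longrightarrow> w \<in> A \<and> w \<in> C') \<and> (w = y \<longrightarrow> w \<in> A \<and> w \<notin> C') \<and> (w = s \<longrightarrow> w \<in> A \<and> w \<in> C)
      \<and> (w = t \<longrightarrow> w \<in> A \<and> w \<in> C) \<and> (w = u \<longrightarrow> w \<in> C \<and> w \<in> C') \<and> (w = v \<longrightarrow> w \<notin> C \<and> w \<notin> C')" for w
    using assms by blast
  note membership = mem_boundary Int_iff Diff_iff insert_iff empty_iff
  show ?first
    apply (rule cut_sum3_le; unfold membership)
    subgoal for a b using position[of a] position[of b] by sat
    subgoal for a b using position[of a] position[of b] by sat
    subgoal for a b using position[of a] position[of b] by sat
    subgoal for a b using position[of a] position[of b] by sat
    subgoal for a b using position[of a] position[of b] by sat
    subgoal for a b using position[of a] position[of b] by sat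
    done
  show ?second
    apply (rule cut_sum3_le; unfold membership)
    subgoal for a b using position[of a] position[of b] by sat
    subgoal for a b using position[of a] position[of b] by sat
    subgoal for a b using position[of a] position[of b] by sat
    subgoal for a b using position[of a] position[of b] by sat
    subgoal for a b using position[of a] position[of b] by sat
    subgoal for a b using position[of a] position[of b] by sat
    done
qed

section \<open>Edges deep inside a small cut\<close>

lemma degree_eq_card_nbrs: "degree E w = card {b. {w, b} \<in> E}"
proof -
  have "(\<lambda>b. {w, b}) ` {b. {w, b} \<in> E} = {e \<in> E. w \<in> e}"
  proof (intro equalityI subsetI)
    fix e assume "e \<in> {e \<in> E. w \<in> e}"
    then have "e \<in> E" "w \<in> e" by auto
    from this(1) obtain a b where "e = {a, b}" by (rule edgeE)
    then show "e \<in> (\<lambda>b. {w, b}) ` {b. {w, b} \<in> E}"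
      using \<open>e \<in> E\<close> \<open>w \<in> e\<close> by (auto simp: insert_commute)
  qed auto
  moreover have "card ((\<lambda>b. {w, b}) ` {b. {w, b} \<in> E}) = card {b. {w, b} \<in> E}"
    by (rule card_image) (auto simp: inj_on_def doubleton_eq_iff)
  ultimately show ?thesis
    by (simp add: degree_def)
qed

lemma finite_nbrs: "finite {b. {w, b} \<in> E \<and> P b}"
  by (rule finite_subset[OF _ finite_V]) (use edge_ends(2) in blast)

text \<open>Vertices of \<open>X\<close> with a neighbour beyond \<open>X \<union> S\<close> number
  at most \<open>cut S X\<close>. Any other vertex has more neighbours than that within
  \<open>X\<close>, so one of these is interior too.\<close>

lemma interior_edge:
  assumes X: "X \<noteq> {}" "X \<subseteq> V - S" and "finite S"
    and deg: "\<And>w. w \<in> X \<Longrightarrow> m \<le> degree E w"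
    and small: "cut S X + card S < m"
  shows "\<exists>x\<in>X. \<exists>y\<in>X. {x, y} \<in> E \<and> (\<forall>b. {x, b} \<in> E \<or> {y, b} \<in> E \<longrightarrow> b \<in> X \<union> S)"
proof -
  define out where "out w = {b. {w, b} \<in> E \<and> b \<notin> X \<union> S}" for w
  have fin: "finite X" "finite (out w)" "finite {b. {w, b} \<in> E}" for w
    using X(2) finite_V finite_nbrs[of w "\<lambda>_. True"] finite_nbrs
    by (auto simp: out_def intro: finite_subset)
  \<comment> \<open>Only \<open>w\<close> lies in \<open>X\<close>, so the edge determines the
    pair.\<close>
  have "inj_on (\<lambda>(w, b). {w, b}) (Sigma X out)"
    by (auto simp: inj_on_def out_def doubleton_eq_iff)
  moreover have "(\<lambda>(w, b). {w, b}) ` Sigma X out \<subseteq> boundary S X"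
    using X(2) by (auto simp: out_def mem_boundary)
  ultimately have "card (Sigma X out) \<le> cut S X"
    unfolding cut_def using finite_boundary by (rule card_inj_on_le)
  then have sum_out: "(\<Sum>w\<in>X. card (out w)) \<le> cut S X"
    using fin by simp
  define inner where "inner = {w \<in> X. out w = {}}"
  have nbrs: "m \<le> card (out w) + card ({b. {w, b} \<in> E} \<inter> X) + card S" if "w \<in> X" for w
  proof -
    have "m \<le> card {b. {w, b} \<in> E}" using deg[OF that] degree_eq_card_nbrs by simp
    also have "\<dots> \<le> card (out w \<union> ({b. {w, b} \<in> E} \<inter> X) \<union> S)"
      using fin \<open>finite S\<close> by (intro card_mono) (auto simp: out_def)
    also have "\<dots> \<le> card (out w) + card ({b. {w, b} \<in> E} \<inter> X) + card S"
      by (meson add_le_mono1 card_Un_le order_trans)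
    finally show ?thesis .
  qed
  have few_outer: "card (X - inner) \<le> cut S X"
  proof -
    have "card (X - inner) = (\<Sum>w\<in>X - inner. 1)" by simp
    also have "\<dots> \<le> (\<Sum>w\<in>X - inner. card (out w))"
      using fin by (intro sum_mono) (auto simp: inner_def Suc_le_eq card_gt_0_iff)
    also have "\<dots> \<le> (\<Sum>w\<in>X. card (out w))"
      using fin by (intro sum_mono2) auto
    finally show ?thesis using sum_out by simp
  qed
  have "inner \<noteq> {}"
  proof
    assume "inner = {}"
    then have "card X \<le> cut S X" using few_outer by simp
    \<comment> \<open>The slack \<open>q\<close> avoids truncated subtraction. At most
      \<open>card X - 1\<close> neighbours lie in \<open>X\<close>, so each vertex sends out at
      least \<open>q + 2\<close> edges, too many in total.\<close>
    define q where "q = m - (card X + card S + 1)"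
    have q: "m = card X + card S + q + 1" using \<open>card X \<le> cut S X\<close> small by (simp add: q_def)
    obtain p where p: "card X = Suc p" using X(1) fin by (metis card_gt_0_iff gr0_implies_Suc)
    have "q + 2 \<le> card (out w)" if "w \<in> X" for w
    proof -
      have "card ({b. {w, b} \<in> E} \<inter> X) \<le> card (X - {w})"
        using fin edge_ends(3) by (intro card_mono) auto
      then show ?thesis using nbrs[OF that] that p q fin by simp
    qed
    then have "card X * (q + 2) \<le> (\<Sum>w\<in>X. card (out w))"
      using sum_bounded_below[of X "q + 2" "\<lambda>w. card (out w)"] by simp
    then have "card X * (q + 2) \<le> cut S X" using sum_out by simp
    moreover have "card X * (q + 2) = p * q + 2 * p + q + 2" using p by (simp add: algebra_simps)
    ultimately show False using small p q by simp
  qed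
  then obtain x where x: "x \<in> inner" by blast
  have "\<not> {b. {x, b} \<in> E} \<inter> X \<subseteq> X - inner"
  proof
    assume "{b. {x, b} \<in> E} \<inter> X \<subseteq> X - inner"
    then have "card ({b. {x, b} \<in> E} \<inter> X) \<le> cut S X"
      using few_outer fin by (meson card_mono finite_Diff order_trans)
    then show False using nbrs[of x] x small by (auto simp: inner_def)
  qed
  then obtain y where y: "{x, y} \<in> E" "y \<in> inner" by blast
  have "b \<in> X \<union> S" if "{w, b} \<in> E" "w \<in> inner" for w b
    using that by (auto simp: inner_def out_def)
  then show ?thesis using x y by (auto simp: inner_def)
qed

section \<open>Robust deletions and minimum cuts\<close>

definition robust :: "nat \<Rightarrow> 'a set \<Rightarrow> bool" where
  "robust k S \<longleftrightarrow> (\<forall>X. X \<noteq> {} \<longrightarrow> X \<subset> V - S \<longrightarrow> k \<le> cut S X)"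

text \<open>Minimality among all cuts of \<open>G - S\<close>, beyond being smaller than
  \<open>k\<close>, is what lets uncrossing return minimum cuts again.\<close>

definition min_cut :: "nat \<Rightarrow> 'a set \<Rightarrow> 'a set \<Rightarrow> bool" where
  "min_cut k S X \<longleftrightarrow> X \<noteq> {} \<and> X \<subset> V - S \<and> cut S X < k \<and>
     (\<forall>Y. Y \<noteq> {} \<longrightarrow> Y \<subset> V - S \<longrightarrow> cut S X \<le> cut S Y)"

lemma not_robust_iff: "\<not> robust k S \<longleftrightarrow> (\<exists>X. min_cut k S X)"
proof
  let ?P = "\<lambda>X. X \<noteq> {} \<and> X \<subset> V - S"
  assume "\<not> robust k S"
  then obtain X where X: "?P X" "cut S X < k" by (auto simp: robust_def not_le)
  from ex_has_least_nat[of ?P, OF X(1), of "cut S"]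
  obtain Y where Y: "?P Y \<and> (\<forall>Z. ?P Z \<longrightarrow> cut S Y \<le> cut S Z)" by (rule exE)
  then have "cut S Y \<le> cut S X" using X(1) by (iprover)
  with Y X(2) show "\<exists>X. min_cut k S X" unfolding min_cut_def
    by (intro exI[of _ Y]) simp
next
  assume "\<exists>X. min_cut k S X"
  then obtain X where "X \<noteq> {}" "X \<subset> V - S" "cut S X < k" unfolding min_cut_def by (elim exE conjE)
  then show "\<not> robust k S" by (auto simp: robust_def not_le)
qed

lemma robustD: "\<lbrakk>robust k S; X \<noteq> {}; X \<subset> V - S\<rbrakk> \<Longrightarrow> k \<le> cut S X"
  by (simp add: robust_def)

lemma min_cut_compl:
  assumes "S \<subseteq> V" "min_cut k S X"
  shows "min_cut k S (V - S - X)"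
proof -
  have "cut S (V - S - X) = cut S X"
    using assms by (intro cut_compl) (auto simp: min_cut_def)
  then show ?thesis using assms unfolding min_cut_def by auto
qed

text \<open>The corner \<open>C - S - A\<close> costs at least as much as the minimum cut
  \<open>A\<close>, so the other corner costs at most as much as \<open>C\<close>.\<close>

lemma min_cut_uncross:
  assumes "S \<subseteq> V" "T \<subseteq> V" "min_cut k S A" "min_cut k T C" "T - S \<subseteq> A"
    and noedge: "\<And>s b. \<lbrakk>s \<in> S - T - C; b \<in> V - S - A - T - C\<rbrakk> \<Longrightarrow> {s, b} \<notin> E"
    and "(A \<union> S) - T - C \<noteq> {}" "C - S - A \<noteq> {}"
  shows "min_cut k T ((A \<union> S) - T - C)"
proof -
  have sub: "A \<subseteq> V - S" "C \<subseteq> V - T" "A \<noteq> {}" "C \<noteq> {}"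
    using assms by (auto simp: min_cut_def)
  have "cut T ((A \<union> S) - T - C) + cut S (C - S - A) \<le> cut S A + cut T C"
    using assms sub by (intro uncross) auto
  moreover have "cut S A \<le> cut S (C - S - A)"
  proof -
    have "C - S - A \<subset> V - S" using sub by blast
    then show ?thesis using assms(3,8) by (simp add: min_cut_def)
  qed
  ultimately have le: "cut T ((A \<union> S) - T - C) \<le> cut T C" by simp
  have "(A \<union> S) - T - C \<subset> V - T" using sub assms(1) by blast
  moreover have "cut T C < k" "\<forall>Y. Y \<noteq> {} \<longrightarrow> Y \<subset> V - T \<longrightarrow> cut T C \<le> cut T Y"
    using assms(4) by (simp_all add: min_cut_def)
  ultimately show ?thesis using le assms(7) unfolding min_cut_def by (meson order_trans order_le_less_trans)
qed

text \<open>With \<open>S - T\<close> inside \<open>C\<close> no deleted vertex has to be absorbed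
  and \<open>noedge\<close> is vacuous.\<close>

lemma min_cut_uncross_nested:
  assumes "S \<subseteq> V" "T \<subseteq> V" "min_cut k S A" "min_cut k T C" "T - S \<subseteq> A" "S - T \<subseteq> C"
    and "A - T - C \<noteq> {}" "C - S - A \<noteq> {}"
  shows "min_cut k T (A - T - C)"
proof -
  have eq: "(A \<union> S) - T - C = A - T - C" using assms(6) by blast
  show ?thesis
    using min_cut_uncross[OF assms(1-5), unfolded eq] assms(6-8) by blast
qed

section \<open>Translation to and from edge-connectivity\<close>

lemma robust_if_k_edge_connected:
  assumes "k_edge_connected V E k"
  shows "robust k {}"
  unfolding robust_def
proof (intro allI impI)
  fix X assume X: "X \<noteq> {}" "X \<subset> V - {}"
  show "k \<le> cut {} X"
  proof (rule ccontr)
    assume "\<not> k \<le> cut {} X"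
    moreover have "boundary {} X \<subseteq> E" by (auto simp: boundary_def)
    ultimately have conn: "connected_graph V (E - boundary {} X)"
      using assms by (simp add: k_edge_connected_def cut_def not_le)
    obtain x y where xy: "x \<in> X" "x \<in> V" "y \<in> V" "y \<notin> X" using X by blast
    have "w \<in> X" if "(x, w) \<in> (adj (E - boundary {} X))\<^sup>*" for w
      using that
    proof induction
      case (step a b)
      then show ?case by (auto simp: adj_def mem_boundary)
    qed (use xy in simp)
    then show False using conn xy by (auto simp: connected_graph_def)
  qed
qed

text \<open>If deleting \<open>U\<close> disconnects \<open>G - S\<close>, the vertices reachable
  from \<open>x\<close> have their whole boundary in \<open>U\<close>. As \<open>robust\<close> is
  vacuous when at most one vertex remains, the trivial graph is excluded separately.\<close>

lemma k_edge_connected_deletion: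
  assumes "robust k S" "2 \<le> card (V - S)"
  shows "k_edge_connected (del_verts_V V S) (del_verts_E E S) k"
proof -
  have "connected_graph (V - S) (del_verts_E E S - U)"
    if U: "U \<subseteq> del_verts_E E S" "card U < k" for U
    unfolding connected_graph_def
  proof (intro conjI ballI)
    show "V - S \<noteq> {}" using assms(2) by (intro notI) simp
    fix x y assume xy: "x \<in> V - S" "y \<in> V - S"
    define R where "R = {w \<in> V - S. (x, w) \<in> (adj (del_verts_E E S - U))\<^sup>*}"
    show "(x, y) \<in> (adj (del_verts_E E S - U))\<^sup>*"
    proof (rule ccontr)
      assume "(x, y) \<notin> (adj (del_verts_E E S - U))\<^sup>*"
      then have "R \<noteq> {}" "R \<subset> V - S" using xy by (auto simp: R_def)
      then have "k \<le> cut S R" using assms(1) by (simp add: robustD)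
      have closed: "b \<in> R" if "a \<in> R" "{a, b} \<in> del_verts_E E S - U" for a b
      proof -
        have "(a, b) \<in> adj (del_verts_E E S - U)" using that(2) by (simp add: adj_def)
        moreover have "b \<in> V - S" using that(2) edge_ends(2) by (auto simp: del_verts_E_def)
        ultimately show ?thesis using that(1) by (auto simp: R_def intro: rtrancl_into_rtrancl)
      qed
      have "boundary S R \<subseteq> U"
      proof
        fix e assume e: "e \<in> boundary S R"
        then have "e \<in> E" by (simp add: boundary_def)
        then obtain a b where ab: "e = {a, b}" by (rule edgeE)
        show "e \<in> U"
        proof (rule ccontr)
          assume "e \<notin> U"
          then have "{a, b} \<in> del_verts_E E S - U" "{b, a} \<in> del_verts_E E S - U"
            using e ab by (auto simp: del_verts_E_def boundary_def insert_commute)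
          then show False using closed[of a b] closed[of b a] e ab by (auto simp: mem_boundary)
        qed
      qed
      moreover have "finite U"
        using U(1) finite_E by (rule_tac finite_subset[of U E]) (auto simp: del_verts_E_def)
      ultimately have "cut S R \<le> card U" by (simp add: cut_def card_mono)
      then show False using \<open>k \<le> cut S R\<close> U(2) by simp
    qed
  qed
  moreover have "V - S \<noteq> {}" using assms(2) by (intro notI) simp
  moreover have "card (V - S) \<noteq> 1" using assms(2) by simp
  ultimately show ?thesis
    by (simp add: k_edge_connected_def del_verts_V_def)
qed

end

section \<open>Edge-critical graphs, the hypothetical counterexamples\<close>

locale edge_critical_graph = fin_graph +
  fixes k :: nat
  assumes connected: "robust k {}"
    and min_deg: "\<And>w. w \<in> V \<Longrightarrow> k + 2 \<le> degree E w"
    and critical: "\<And>u v. {u, v} \<in> E \<Longrightarrow> \<not> robust k {u, v}"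
begin

text \<open>Restoring \<open>S - S'\<close> would leave \<open>C\<close> a cut with fewer than
  \<open>k\<close> edges in the robust graph \<open>G - S'\<close>.\<close>

lemma no_remote_side:
  assumes "S \<subseteq> V" "robust k S'" "S' \<subseteq> S" "min_cut k S C"
    and "\<And>w d. \<lbrakk>w \<in> S - S'; d \<in> C\<rbrakk> \<Longrightarrow> {w, d} \<notin> E"
  shows False
proof -
  have C: "C \<noteq> {}" "C \<subset> V - S" "cut S C < k" using assms(4) by (auto simp: min_cut_def)
  have "cut S' C \<le> cut S C"
    using assms(3,5) C(2) by (intro cut_le_drop) auto
  moreover have "C \<subset> V - S'" using assms(3) C(2) by blast
  then have "k \<le> cut S' C" using assms(2) C(1) by (simp add: robustD)
  ultimately show False using C(3) by simp
qed

section \<open>Remote vertices and the main contradiction\<close>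

definition split :: "'a set \<Rightarrow> 'a set \<Rightarrow> bool" where
  "split B X \<longleftrightarrow> X \<inter> B \<noteq> {} \<and> \<not> B \<subseteq> X"

definition remote :: "'a set \<Rightarrow> 'a set" where
  "remote B = {w \<in> V - B. \<forall>b\<in>B. {w, b} \<notin> E}"

lemma unsplit_side:
  assumes "min_cut k S C" "\<not> split B C" "S \<subseteq> V" "S \<inter> B = {}" "B \<subseteq> V" "p \<in> V - S"
  obtains C' where "min_cut k S C'" "\<not> split B C'" "p \<in> C'"
proof (cases "p \<in> C")
  case True
  then show ?thesis using that assms by blast
next
  case False
  show ?thesis
    by (rule that[of "V - S - C"]) (use assms False min_cut_compl in \<open>auto simp: split_def\<close>)
qed

text \<open>\<open>B0\<close> is empty when all vertices can be deleted safely; otherwise it is the far side of a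
  smallest minimum cut of some \<open>G - z\<close>.\<close>

lemma remote_core_impossible:
  assumes B0: "B0 \<subseteq> V"
    and good: "\<And>j. j \<in> remote B0 \<Longrightarrow> robust k {j}"
    and unsplit: "\<And>x y. \<lbrakk>x \<in> remote B0; y \<in> remote B0; \<not> robust k {x, y}\<rbrakk>
      \<Longrightarrow> \<exists>C. min_cut k {x, y} C \<and> \<not> split B0 C"
    and edge: "a \<in> remote B0" "b \<in> remote B0" "{a, b} \<in> E"
  shows False
proof -
  define J where "J = remote B0"
  have J: "J \<subseteq> V" "J \<inter> B0 = {}" by (auto simp: J_def remote_def)
  let ?P = "\<lambda>(u, v, A). u \<in> J \<and> v \<in> J \<and> min_cut k {u, v} A \<and> A \<inter> B0 = {}"
  obtain C where C: "min_cut k {a, b} C" "\<not> split B0 C"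
    using unsplit edge critical by blast
  \<comment> \<open>An unsplit cut that meets \<open>B0\<close> contains it, so its complement
    misses it.\<close>
  have "\<exists>A. ?P (a, b, A)"
  proof (cases "C \<inter> B0 = {}")
    case True
    then show ?thesis using C edge J_def by auto
  next
    case False
    then have "(V - {a, b} - C) \<inter> B0 = {}" using C(2) by (auto simp: split_def)
    moreover have "min_cut k {a, b} (V - {a, b} - C)"
      using C(1) edge J by (intro min_cut_compl) (auto simp: J_def)
    ultimately show ?thesis using edge J_def by blast
  qed
  then obtain A0 where "?P (a, b, A0)" by blast
  from ex_has_least_nat[of ?P, OF this, of "\<lambda>(u, v, A). card A"]
  obtain h where h: "?P h \<and> (\<forall>h'. ?P h' \<longrightarrow> (\<lambda>(u, v, A). card A) h \<le> (\<lambda>(u, v, A). card A) h')"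
    by (rule exE)
  obtain u v A where "h = (u, v, A)" by (cases h)
  with h have uv: "u \<in> J" "v \<in> J" and A: "min_cut k {u, v} A" "A \<inter> B0 = {}"
    and least: "\<forall>x y X. x \<in> J \<and> y \<in> J \<and> min_cut k {x, y} X \<and> X \<inter> B0 = {} \<longrightarrow> card A \<le> card X"
    by auto
  from least have A_least: "card A \<le> card X"
    if "x \<in> J" "y \<in> J" "min_cut k {x, y} X" "X \<inter> B0 = {}" for x y X
    using that by blast
  have A_sub: "A \<noteq> {}" "A \<subset> V - {u, v}" "cut {u, v} A < k" using A(1) by (auto simp: min_cut_def)
  have fin: "finite X" if "X \<subseteq> V" for X using that finite_V finite_subset by blast
  have finA: "finite A" using fin[of A] A_sub(2) by blast
  have "u \<noteq> v" using A(1) good uv(1) not_robust_iff[of k "{u}"] by (auto simp: J_def)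
  define B where "B = V - {u, v} - A"
  have B: "B0 \<subseteq> B" using B0 A(2) uv J by (auto simp: B_def)
  \<comment> \<open>Since \<open>B0\<close> lies in \<open>B\<close>, these vertices are remote from
    \<open>B0\<close>, and \<open>good\<close> and \<open>unsplit\<close> apply to them.\<close>
  define I where "I = {w \<in> A. \<forall>b\<in>B. {w, b} \<notin> E}"
  have I: "I \<subseteq> A" "I \<subseteq> J" "I \<inter> B0 = {}"
    using A_sub(2) B A(2) by (auto simp: I_def J_def remote_def)
  have I_B: "{w, b} \<notin> E" "{b, w} \<notin> E" if "w \<in> I" "b \<in> B" for w b
    using that by (auto simp: I_def insert_commute)

  \<comment> \<open>Exchanging \<open>p\<close> for \<open>x\<close> gives a robust pair: otherwise
    uncrossing with \<open>A\<close> yields a smaller cut. Hence no vertex of \<open>I\<close> is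
    adjacent to \<open>u\<close> or \<open>v\<close>, as that edge would be critical.\<close>
  have good_pair: "robust k {x, q}" if x: "x \<in> I" and pq: "{p, q} = {u, v}" for x p q
  proof (rule ccontr)
    assume "\<not> robust k {x, q}"
    moreover have x': "x \<in> J" "x \<in> A" "x \<in> V" "x \<noteq> p" "x \<noteq> q" "p \<noteq> q"
      "p \<in> J" "q \<in> J" "p \<in> V" "q \<in> V" "{p, q} \<subseteq> V" "{x, q} \<subseteq> V"
      using x I pq J uv \<open>u \<noteq> v\<close> A_sub(2) by (auto simp: doubleton_eq_iff)
    ultimately obtain C0 where "min_cut k {x, q} C0" "\<not> split B0 C0"
      using unsplit by (auto simp: J_def)
    then obtain C where C: "min_cut k {x, q} C" "p \<in> C"
      by (rule unsplit_side[of _ _ _ p]) (use x' J B0 in auto)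
    have C_sub: "C \<subseteq> V - {x, q}" "C \<noteq> {}" using C(1) by (auto simp: min_cut_def)
    \<comment> \<open>Otherwise the side opposite \<open>C\<close> lies in \<open>B\<close>, where
      \<open>x\<close> has no neighbours, and is already a small cut of
      \<open>G - q\<close>.\<close>
    have "A - {x, q} - C \<noteq> {}"
    proof
      assume "A - {x, q} - C = {}"
      then have "V - {x, q} - C \<subseteq> B" using C(2) pq by (auto simp: B_def)
      then show False
        using C(1) x' I_B[OF x] good[of q]
        by (intro no_remote_side[of "{x, q}" "{q}" "V - {x, q} - C"] min_cut_compl)
          (auto simp: J_def)
    qed
    then obtain d where d: "d \<in> A" "d \<noteq> x" "d \<noteq> q" "d \<notin> C" by blast
    \<comment> \<open>Otherwise \<open>C\<close> trades \<open>x\<close> and \<open>d\<close> for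
      \<open>p\<close> alone and is smaller than \<open>A\<close>.\<close>
    have "C - {p, q} - A \<noteq> {}"
    proof
      assume "C - {p, q} - A = {}"
      then have CA: "C \<subseteq> (A - {x, d}) \<union> {p}" using C_sub d by auto
      then have "C \<inter> B0 = {}" using A(2) J x'(7) by auto
      then have "card A \<le> card C" using A_least C(1) x' by blast
      moreover have "card C < card A"
        by (rule card_exchange_less[OF finA _ _ CA]) (use x' d in auto)
      ultimately show False by simp
    qed
    have "min_cut k {p, q} A" using A(1) pq by simp
    then have "min_cut k {x, q} (A - {x, q} - C)"
      by (rule min_cut_uncross_nested[OF x'(11,12) _ C(1)])
        (use x' C(2) d \<open>C - {p, q} - A \<noteq> {}\<close> in auto)
    then have "card A \<le> card (A - {x, q} - C)" using A_least x' A(2) by blast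
    moreover have "A - {x, q} - C \<subset> A" using x' by blast
    ultimately show False using finA psubset_card_mono[of A "A - {x, q} - C"] by simp
  qed

  have nbrs_I: "b \<in> A" if "x \<in> I" "{x, b} \<in> E" for x b
  proof -
    have "b \<noteq> u" "b \<noteq> v"
      using good_pair[OF that(1), of u v] good_pair[OF that(1), of v u] critical that(2) by blast+
    moreover have "b \<notin> B" using I_B that by blast
    ultimately show ?thesis using edge_ends(2)[OF that(2)] by (simp add: B_def)
  qed

  \<comment> \<open>The pattern of \<open>good_pair\<close> again: with \<open>u\<close> and
    \<open>v\<close> both in \<open>C\<close>, nested uncrossing shrinks \<open>A\<close>.\<close>
  have same_side: False
    if xy: "x \<in> I" "y \<in> I" and C: "min_cut k {x, y} C" "u \<in> C" "v \<in> C" for x y C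
  proof -
    have C_sub: "C \<subseteq> V - {x, y}" "C \<noteq> {}" using C(1) by (auto simp: min_cut_def)
    have xy': "x \<in> A" "y \<in> A" "x \<in> J" "y \<in> J" "{x, y} \<subseteq> V" "{u, v} \<subseteq> V"
      using xy I J uv by auto
    have "x \<noteq> y" using C(1) good xy'(3) not_robust_iff[of k "{x}"] by (auto simp: J_def)
    have "A - {x, y} - C \<noteq> {}"
    proof
      assume "A - {x, y} - C = {}"
      then have "V - {x, y} - C \<subseteq> B" using C(2,3) by (auto simp: B_def)
      then show False
        using C(1) xy' I_B[OF xy(1)] I_B[OF xy(2)] connected
        by (intro no_remote_side[of "{x, y}" "{}" "V - {x, y} - C"] min_cut_compl) auto
    qed
    then obtain d where d: "d \<in> A" "d \<noteq> x" "d \<noteq> y" "d \<notin> C" by blast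
    have "C - {u, v} - A \<noteq> {}"
    proof
      assume "C - {u, v} - A = {}"
      then have CA: "C \<subseteq> (A - {x, y, d}) \<union> {u, v}" using C_sub d by auto
      then have "C \<inter> B0 = {}" using A(2) J uv by auto
      then have "card A \<le> card C" using A_least C(1) xy' by blast
      moreover have "card C < card A"
        by (rule card_exchange_less[OF finA _ _ CA]) (use xy' d \<open>x \<noteq> y\<close> \<open>u \<noteq> v\<close> in auto)
      ultimately show False by simp
    qed
    then have "min_cut k {x, y} (A - {x, y} - C)"
      using \<open>A - {x, y} - C \<noteq> {}\<close> xy' C(2,3)
      by (intro min_cut_uncross_nested[OF xy'(6,5) A(1) C(1)]) auto
    then have "card A \<le> card (A - {x, y} - C)" using A_least xy' A(2) by blast
    moreover have "A - {x, y} - C \<subset> A" using xy' by blast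
    ultimately show False using finA psubset_card_mono[of A "A - {x, y} - C"] by simp
  qed

  have separates: "(u \<in> C) \<noteq> (v \<in> C)" if xy: "x \<in> I" "y \<in> I" and C: "min_cut k {x, y} C" for x y C
  proof (rule ccontr)
    assume "\<not> (u \<in> C) \<noteq> (v \<in> C)"
    moreover have "u \<notin> {x, y}" "v \<notin> {x, y}" "{x, y} \<subseteq> V" "u \<in> V" "v \<in> V"
      using xy I A_sub(2) J uv by auto
    moreover from this have "min_cut k {x, y} (V - {x, y} - C)" using C by (intro min_cut_compl)
    ultimately show False
      using same_side[OF xy C] same_side[OF xy, of "V - {x, y} - C"] by blast
  qed

  \<comment> \<open>Otherwise \<open>C\<close> loses \<open>x\<close> and \<open>y\<close> from
    \<open>A\<close> and gains only one of \<open>u\<close> and \<open>v\<close>, as it separates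
    them.\<close>
  have meets_B: "C - A - {u, v} \<noteq> {}"
    if xy: "x \<in> I" "y \<in> I" and C: "min_cut k {x, y} C" for x y C
  proof
    assume *: "C - A - {u, v} = {}"
    have C_sub: "C \<subseteq> V - {x, y}" "C \<noteq> {}" using C by (auto simp: min_cut_def)
    have xy': "x \<in> A" "y \<in> A" "x \<in> J" "y \<in> J" using xy I by auto
    have "x \<noteq> y" using C good xy'(3) not_robust_iff[of k "{x}"] by (auto simp: J_def)
    obtain p where p: "C \<subseteq> (A - {x, y}) \<union> {p}" using * C_sub separates[OF xy C] by blast
    have "C \<inter> B0 = {}" using A(2) J uv * by auto
    then have "card A \<le> card C" using A_least C xy' by blast
    moreover have "card C < card A"
      by (rule card_exchange_less[OF finA _ _ p]) (use xy' \<open>x \<noteq> y\<close> in auto)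
    ultimately show False by simp
  qed

  have "card {u, v} = 2" using \<open>u \<noteq> v\<close> by simp
  then have "\<exists>x\<in>A. \<exists>y\<in>A. {x, y} \<in> E \<and> (\<forall>b. {x, b} \<in> E \<or> {y, b} \<in> E \<longrightarrow> b \<in> A \<union> {u, v})"
    using A_sub min_deg by (intro interior_edge[where m="k + 2"]) auto
  then obtain x0 y0 where x0: "x0 \<in> A" "y0 \<in> A" "{x0, y0} \<in> E"
    "\<And>b. {x0, b} \<in> E \<Longrightarrow> b \<in> A \<union> {u, v}" "\<And>b. {y0, b} \<in> E \<Longrightarrow> b \<in> A \<union> {u, v}"
    by blast
  then have x0I: "x0 \<in> I" "y0 \<in> I" by (auto simp: I_def B_def)
  \<comment> \<open>Second extremal choice: \<open>A\<close> stays fixed and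
    \<open>card (A \<inter> C)\<close> is minimized.\<close>
  let ?Q = "\<lambda>(x, y, C). x \<in> I \<and> y \<in> I \<and> min_cut k {x, y} C \<and> \<not> split B0 C"
  obtain C0 where "?Q (x0, y0, C0)"
    using unsplit[of x0 y0] x0I I(2) critical[OF x0(3)] by (auto simp: J_def)
  from ex_has_least_nat[of ?Q, OF this, of "\<lambda>(x, y, C). card (A \<inter> C)"]
  obtain h where h: "?Q h \<and> (\<forall>h'. ?Q h' \<longrightarrow>
      (\<lambda>(x, y, C). card (A \<inter> C)) h \<le> (\<lambda>(x, y, C). card (A \<inter> C)) h')"
    by (rule exE)
  obtain x y C where "h = (x, y, C)" by (cases h)
  with h have xyI: "x \<in> I" "y \<in> I" and C: "min_cut k {x, y} C" "\<not> split B0 C"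
    and least: "\<forall>x y X. x \<in> I \<and> y \<in> I \<and> min_cut k {x, y} X \<and> \<not> split B0 X
      \<longrightarrow> card (A \<inter> C) \<le> card (A \<inter> X)"
    by auto
  from least have C_least: "card (A \<inter> C) \<le> card (A \<inter> X)"
    if "x \<in> I" "y \<in> I" "min_cut k {x, y} X" "\<not> split B0 X" for x y X
    using that by blast
  obtain p q where pq: "{p, q} = {u, v}" "p \<in> C" "q \<notin> C"
    using separates[OF xyI C(1)] by blast

  have Apq: "min_cut k {p, q} A" using A(1) pq(1) by simp
  have pq': "p \<in> J" "q \<in> J" "p \<in> V" "q \<in> V" "p \<notin> A" "q \<notin> A"
    using pq(1) uv J(1) A_sub(2) unfolding doubleton_eq_iff by blast+
  have "p = u \<and> q = v \<or> p = v \<and> q = u" using pq(1) by (simp only: doubleton_eq_iff)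
  then have separates_pq: "(p \<in> X) \<noteq> (q \<in> X)" if "x \<in> I" "y \<in> I" "min_cut k {x, y} X" for x y X
    using separates[OF that] by auto
  have robust_pq: "robust k {p}" "robust k {q}" using good pq' by (simp_all add: J_def)
  have C_sub: "C \<subseteq> V - {x, y}" "C \<noteq> {}" "cut {x, y} C < k" using C(1) by (auto simp: min_cut_def)
  have xyA: "x \<in> A" "y \<in> A" "x \<in> V" "y \<in> V" "x \<in> J" "y \<in> J" "{x, y} \<subseteq> V"
    using xyI I J by auto
  have C_compl: "min_cut k {x, y} (V - {x, y} - C)" using C(1) xyA(7) by (intro min_cut_compl)
  have "A \<inter> C \<noteq> {}"
  proof
    assume "A \<inter> C = {}"
    then show False
      using nbrs_I[OF xyI(1)] nbrs_I[OF xyI(2)] C(1) connected xyA(7)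
      by (intro no_remote_side[of "{x, y}" "{}" C]) auto
  qed
  have CD_B: "C - A - {p, q} \<noteq> {}" "V - A - {p, q} - C \<noteq> {}"
    using meets_B[OF xyI C(1)] meets_B[OF xyI C_compl] pq(1) by blast+
  \<comment> \<open>The two cuts total at most \<open>2 * (k - 1)\<close> and the far corner takes
    at least \<open>k\<close>. The remaining \<open>k - 2\<close>, plus three deleted vertices, is
    still below the degree bound \<open>k + 2\<close>.\<close>
  have "cut {p, x, y} (A \<inter> C) + 2 \<le> k"
  proof -
    have "k \<le> cut {q} (V - A - {p, q} - C)"
      by (rule robustD[OF robust_pq(2) CD_B(2)]) (use pq' pq(2,3) in blast)
    moreover have "cut {q} (V - A - {p, q} - C) + cut {p, x, y} (A \<inter> C) \<le> cut {p, q} A + cut {x, y} C"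
      using A_sub(2) pq(1) by (intro cut_diagonal[OF _ C_sub(1) xyA(1,2) pq(2,3)]) simp
    moreover have "cut {p, q} A < k" using A_sub(3) pq(1) by simp
    ultimately show ?thesis using C_sub(3) by linarith
  qed
  moreover have "card {p, x, y} \<le> 3" by (simp add: card_insert_if)
  ultimately have "cut {p, x, y} (A \<inter> C) + card {p, x, y} < k + 2" by linarith
  then have "\<exists>s\<in>A \<inter> C. \<exists>t\<in>A \<inter> C. {s, t} \<in> E \<and>
      (\<forall>b. {s, b} \<in> E \<or> {t, b} \<in> E \<longrightarrow> b \<in> A \<inter> C \<union> {p, x, y})"
    using \<open>A \<inter> C \<noteq> {}\<close> C_sub(1) pq' xyA min_deg
    by (intro interior_edge[where m="k + 2"]) auto
  then obtain s t where st: "s \<in> A \<inter> C" "t \<in> A \<inter> C" "{s, t} \<in> E"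
    and st_nbrs: "\<And>b. {s, b} \<in> E \<Longrightarrow> b \<in> A \<inter> C \<union> {p, x, y}" "\<And>b. {t, b} \<in> E \<Longrightarrow> b \<in> A \<inter> C \<union> {p, x, y}"
    by blast
  have stI: "s \<in> I" "t \<in> I"
    using st(1,2) st_nbrs xyA(1,2) pq(1) unfolding I_def B_def by blast+
  have st_nbrs': "b \<in> A \<inter> C \<union> {x, y}" if "{w, b} \<in> E" "w \<in> {s, t}" for w b
    using that st_nbrs nbrs_I stI xyA pq'(5) by blast
  have st': "s \<noteq> t" "s \<in> V" "t \<in> V" "{s, t} \<subseteq> V" "s \<noteq> p" "s \<noteq> q" "t \<noteq> p" "t \<noteq> q"
    "s \<notin> {x, y}" "t \<notin> {x, y}" "s \<in> J" "t \<in> J"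
    using edge_ends[OF st(3)] st pq' C_sub stI I by auto
  obtain C0' where "min_cut k {s, t} C0'" "\<not> split B0 C0'"
    using unsplit[of s t] st' critical[OF st(3)] by (auto simp: J_def)
  then obtain C' where C': "min_cut k {s, t} C'" "\<not> split B0 C'" "p \<in> C'"
    by (rule unsplit_side[of _ _ _ p]) (use st' J B0 pq' in auto)
  have C'_sub: "C' \<subseteq> V - {s, t}" "C' \<noteq> {}" "cut {s, t} C' < k" using C'(1) by (auto simp: min_cut_def)
  have "q \<notin> C'" using separates_pq[OF stI C'(1)] C'(3) by simp
  define D' where "D' = V - {s, t} - C'"
  have D': "min_cut k {s, t} D'" unfolding D'_def using C'(1) st'(4) by (intro min_cut_compl)
  have "q \<in> D'" using \<open>q \<notin> C'\<close> pq' st' by (auto simp: D'_def)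
  have fin_AC: "finite (A \<inter> C)" using finA by simp

  \<comment> \<open>The case where \<open>C'\<close> separates \<open>x\<close> from
    \<open>y\<close>; the neighbours \<open>n\<close> and \<open>m\<close> found below make the
    cells inside \<open>A\<close> nonempty.\<close>
  have crossing: False if xy0: "{x0, y0} = {x, y}" "x0 \<in> C'" "y0 \<notin> C'" for x0 y0
  proof -
    have x0: "x0 \<in> I" "y0 \<in> I" "x0 \<in> A" "y0 \<in> A" "x0 \<in> J" "y0 \<in> J" "x0 \<in> V" "y0 \<in> V" "x0 \<noteq> y0"
      "{x0, y0} \<subseteq> V" "x0 \<notin> C" "y0 \<notin> C" "x0 \<notin> {s, t}" "y0 \<notin> {s, t}" "x0 \<notin> B0" "y0 \<notin> B0"
      "q \<noteq> x0" "q \<noteq> y0" "p \<noteq> x0" "p \<noteq> y0"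
      using xy0 xyI xyA st' C_sub(1) I(3) pq' unfolding doubleton_eq_iff by blast+
    have C0: "min_cut k {x0, y0} C" using C(1) xy0(1) by simp
    \<comment> \<open>Otherwise \<open>x0\<close> can be absorbed:
      \<open>insert x0 (C \<inter> C')\<close> is a minimum cut of \<open>G - {s, t}\<close> with a
      smaller part in \<open>A\<close>.\<close>
    have "\<exists>n. {x0, n} \<in> E \<and> n \<in> V - {x0, y0} - C - D'"
    proof (rule ccontr)
      assume none: "\<not> ?thesis"
      have "min_cut k {s, t} ((C \<union> {x0, y0}) - {s, t} - D')"
        by (rule min_cut_uncross[OF x0(10) st'(4) C0 D'])
          (use none st xy0(2,3) x0 \<open>q \<in> D'\<close> pq(3) pq' in \<open>auto simp: D'_def\<close>)
      moreover have eq: "(C \<union> {x0, y0}) - {s, t} - D' = insert x0 (C \<inter> C')"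
        using xy0(2,3) x0 C'_sub(1) C_sub(1) by (auto simp: D'_def)
      moreover have "\<not> split B0 (insert x0 (C \<inter> C'))"
        using C(2) C'(2) x0(15) by (auto simp: split_def)
      ultimately have "card (A \<inter> C) \<le> card (A \<inter> insert x0 (C \<inter> C'))"
        using C_least stI by simp
      moreover have "card (A \<inter> insert x0 (C \<inter> C')) < card (A \<inter> C)"
        by (rule card_exchange_less[of _ "{s, t}" "{x0}"]) (use fin_AC st st' C'_sub(1) in auto)
      ultimately show False by simp
    qed
    then obtain n where n: "{x0, n} \<in> E" "n \<in> V - {x0, y0} - C - D'" by blast
    have nA: "n \<in> A" "n \<in> C'" "n \<notin> C"
      using n nbrs_I x0 st by (auto simp: D'_def)
    \<comment> \<open>Otherwise absorbing \<open>y0\<close> gives a minimum cut of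
      \<open>G - {s, t}\<close> that contains neither \<open>p\<close> nor \<open>q\<close>.\<close>
    have "\<exists>m. {y0, m} \<in> E \<and> m \<in> V - {x0, y0} - C - {s, t} - C'"
    proof (rule ccontr)
      assume none: "\<not> ?thesis"
      have "min_cut k {s, t} ((C \<union> {x0, y0}) - {s, t} - C')"
        by (rule min_cut_uncross[OF x0(10) st'(4) C0 C'(1)])
          (use none st xy0(2,3) x0 n nA in auto)
      then show False
        using separates_pq[OF stI] pq(3) C'(3) x0(17-20) by blast
    qed
    then obtain m where m: "{y0, m} \<in> E" "m \<in> V - {x0, y0} - C - {s, t} - C'" by blast
    have mA: "m \<in> A" using m nbrs_I x0 by blast
    have less: "cut {p, q} A < k" "cut {x0, y0} C < k" using A_sub(3) C_sub(3) pq(1) xy0(1) by simp_all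
    have C'D'_B: "C' - A - {p, q} \<noteq> {}" "V - A - {p, q} - C' \<noteq> {}"
      using meets_B[OF stI C'(1)] meets_B[OF stI D'] pq(1) unfolding D'_def by blast+
    have sub: "A \<subseteq> V - {p, q}" "C \<subseteq> V - {x0, y0}" using A_sub(2) C_sub(1) pq(1) xy0(1) by auto
    note cuts = three_cuts[OF sub C'_sub(1) x0(3,4) _ _ _ _ pq(2,3) C'(3) \<open>q \<notin> C'\<close> xy0(2,3)]
    show False
    \<comment> \<open>Both sides of \<open>C\<close> and of \<open>C'\<close> meet \<open>B\<close>,
      so two opposite cells of \<open>B\<close> are nonempty. Together with the cell of
      \<open>n\<close> or of \<open>m\<close> they have boundaries adding up to at least
      \<open>3 * k\<close>.\<close>
    proof (cases "C \<inter> C' - A - {p, q} \<noteq> {} \<and> V - A - {p, q} - C - C' \<noteq> {}")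
      case True
      have "k \<le> cut {x0} ((A \<inter> C') - {x0, y0} - C)"
        by (rule robustD[of _ "{x0}"]) (use good[of x0] x0 n nA sub pq' in \<open>auto simp: J_def\<close>)
      moreover have "k \<le> cut {p} (C \<inter> C' - A - {p, q})"
        by (rule robustD[OF robust_pq(1)]) (use True sub pq' pq(2,3) in blast)+
      moreover have "k \<le> cut {q} (V - A - {p, q} - C - C')"
        by (rule robustD[OF robust_pq(2)]) (use True pq' pq(2,3) in blast)+
      ultimately show False using cuts(1) st less C'_sub(3) by auto
    next
      case False
      then have ne: "C - A - {p, q} - C' \<noteq> {}" "C' - A - {p, q} - C \<noteq> {}"
        using CD_B C'D'_B by blast+
      have "k \<le> cut {q, y0} (A - {x0, y0} - C - {s, t} - C')"
        unfolding insert_commute[of q y0]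
        by (rule robustD[OF good_pair[OF x0(2) pq(1)]]) (use m mA x0 sub pq' pq(2,3) in blast)+
      moreover have "k \<le> cut {} (C - A - {p, q} - C')"
        by (rule robustD[OF connected ne(1)]) (use sub pq' in blast)
      moreover have "k \<le> cut {} (C' - A - {p, q} - C)"
        by (rule robustD[OF connected ne(2)]) (use C'_sub(1) pq' in blast)
      ultimately show False using cuts(2) st less C'_sub(3) by auto
    qed
  qed

  consider "x \<notin> C'" "y \<notin> C'" | "x \<in> C'" "y \<in> C'" | "x \<in> C'" "y \<notin> C'" | "y \<in> C'" "x \<notin> C'" by blast
  then show False
  proof cases
    \<comment> \<open>Uncrossing with \<open>D'\<close> replaces \<open>C\<close> by
      \<open>C \<inter> C'\<close>, which misses \<open>s\<close> and \<open>t\<close>.\<close>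
    case 1
    then have xyD': "x \<in> D'" "y \<in> D'" using xyA st' by (auto simp: D'_def)
    have eq: "C - {s, t} - D' = C \<inter> C'" using C'_sub(1) C_sub(1) by (auto simp: D'_def)
    have "{s, t} - {x, y} \<subseteq> C" "{x, y} - {s, t} \<subseteq> D'" using st xyD' by blast+
    moreover have "p \<in> C - {s, t} - D'" using pq(2) C'(3) eq by blast
    moreover have "q \<in> D' - {x, y} - C" using \<open>q \<in> D'\<close> pq(3) pq'(6) xyA by blast
    ultimately have "min_cut k {s, t} (C - {s, t} - D')"
      by (intro min_cut_uncross_nested[OF xyA(7) st'(4) C(1) D']) blast+
    moreover have "\<not> split B0 (C \<inter> C')" using C(2) C'(2) by (auto simp: split_def)
    ultimately have "card (A \<inter> C) \<le> card (A \<inter> (C \<inter> C'))" using C_least stI eq by simp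
    moreover have "card (A \<inter> (C \<inter> C')) < card (A \<inter> C)"
      using st C'_sub(1) fin_AC by (intro psubset_card_mono) auto
    ultimately show False by simp
  next
    case 2
    \<comment> \<open>Otherwise \<open>s\<close> and \<open>t\<close> have no neighbours in
      \<open>D'\<close>, which would then be a small cut of \<open>G\<close>.\<close>
    have "A \<inter> C \<inter> D' \<noteq> {}"
    proof
      assume *: "A \<inter> C \<inter> D' = {}"
      show False
        by (rule no_remote_side[OF st'(4) connected _ D'])
          (use * st_nbrs' 2 in \<open>auto simp: D'_def\<close>)
    qed
    then obtain d where d: "d \<in> A" "d \<in> C" "d \<in> D'" by blast
    show False
    \<comment> \<open>If \<open>C'\<close> leaves \<open>C \<union> {x, y}\<close>, then
      \<open>C - C'\<close> is a minimum cut avoiding both \<open>p\<close> and \<open>q\<close>. If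
      not, \<open>A \<inter> C'\<close> trades \<open>s\<close>, \<open>t\<close> and
      \<open>d\<close> for at most \<open>x\<close> and \<open>y\<close>.\<close>
    proof (cases "C' - {x, y} - C = {}")
      case False
      have "d \<in> C - {s, t} - C'" using d by (simp add: D'_def)
      then have X: "min_cut k {s, t} (C - {s, t} - C')"
        using st(1,2) 2 False by (intro min_cut_uncross_nested[OF xyA(7) st'(4) C(1) C'(1)]) blast+
      then show False
        using separates_pq[OF stI X] pq(3) C'(3) \<open>q \<notin> C'\<close> by blast
    next
      case True
      have "card (A \<inter> C) \<le> card (A \<inter> C')" using C_least stI C' by blast
      moreover have "card (A \<inter> C') < card (A \<inter> C)"
      proof (rule card_exchange_less[OF fin_AC])
        show "{s, t, d} \<subseteq> A \<inter> C" using st d by blast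
        show "A \<inter> C' \<subseteq> (A \<inter> C - {s, t, d}) \<union> {x, y}" using True d C'_sub(1) by (auto simp: D'_def)
        show "card {x, y} < card {s, t, d}" using d st'(1) by (auto simp: D'_def card_insert_if)
      qed simp
      ultimately show False by simp
    qed
  next
    case 3
    then show False using crossing by blast
  next
    case 4
    then show False using crossing[of y x] by blast
  qed
qed

section \<open>The two cases: every vertex deletion is robust, or some is not\<close>

lemma all_robust_impossible:
  assumes "V \<noteq> {}" "\<And>z. z \<in> V \<Longrightarrow> robust k {z}"
  shows False
proof -
  have remote: "remote {} = V" by (simp add: remote_def)
  obtain w where w: "w \<in> V" using assms(1) by blast
  then have "{b. {w, b} \<in> E} \<noteq> {}"
    using min_deg[OF w] degree_eq_card_nbrs[of w] by (intro notI) simp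
  then obtain b where wb: "{w, b} \<in> E" by blast
  show False
  \<comment> \<open>With an empty core every vertex is remote and no set is split.\<close>
  proof (rule remote_core_impossible[of "{}" w b, unfolded remote])
    show "\<exists>C. min_cut k {x, y} C \<and> \<not> split {} C" if "\<not> robust k {x, y}" for x y
      using that by (simp add: not_robust_iff split_def)
  qed (use assms(2) wb w edge_ends[OF wb] in auto)
qed

lemma non_robust_vertex_impossible:
  assumes "z0 \<in> V" "\<not> robust k {z0}"
  shows False
proof -
  let ?P = "\<lambda>(z, A). z \<in> V \<and> min_cut k {z} A"
  obtain A0 where "?P (z0, A0)" using assms by (auto simp: not_robust_iff)
  from ex_has_least_nat[of ?P, OF this, of "\<lambda>(z, A). card A"]
  obtain h where h: "?P h \<and> (\<forall>h'. ?P h' \<longrightarrow> (\<lambda>(z, A). card A) h \<le> (\<lambda>(z, A). card A) h')"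
    by (rule exE)
  obtain z A where "h = (z, A)" by (cases h)
  with h have z: "z \<in> V" and A: "min_cut k {z} A"
    and A_least: "\<And>x X. x \<in> V \<Longrightarrow> min_cut k {x} X \<Longrightarrow> card A \<le> card X"
    by auto
  have A_sub: "A \<noteq> {}" "A \<subseteq> V - {z}" "cut {z} A < k" using A by (auto simp: min_cut_def)
  have finA: "finite A" using A_sub(2) finite_V finite_subset by blast
  define B where "B = V - {z} - A"
  have B: "min_cut k {z} B" unfolding B_def using A z by (intro min_cut_compl) auto
  \<comment> \<open>This keeps \<open>z\<close> out of \<open>remote B\<close>, so remote vertices
    lie in \<open>A\<close>.\<close>
  have "\<exists>b\<in>B. {z, b} \<in> E"
  proof (rule ccontr)
    assume *: "\<not> ?thesis"
    show False
      by (rule no_remote_side[OF _ connected _ B]) (use * z in auto)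
  qed
  then have remote: "x \<in> A" "x \<in> V" "x \<noteq> z" "\<And>b. b \<in> B \<Longrightarrow> {x, b} \<notin> E" if "x \<in> remote B" for x
    using that A_sub(2) by (auto simp: remote_def B_def)
  have unmixed: "A - T - C \<noteq> {}"
    if T: "T \<subseteq> remote B" and C: "min_cut k T C" "z \<in> C" for T C
  proof
    assume "A - T - C = {}"
    then have "V - T - C \<subseteq> B" using C(2) by (auto simp: B_def)
    then have "{w, d} \<notin> E" if "w \<in> T - {}" "d \<in> V - T - C" for w d
      using that T remote(4) by blast
    moreover have "T \<subseteq> V" using T remote(2) by blast
    ultimately show False
      using no_remote_side[OF _ connected _ min_cut_compl[OF _ C(1)]] by blast
  qed
  \<comment> \<open>Uncrossing with \<open>A\<close> moves the cut inside \<open>A\<close>, where it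
    cannot split \<open>B\<close>.\<close>
  have nested: "min_cut k T (A - T - C)"
    if T: "T \<subseteq> remote B" and C: "min_cut k T C" "z \<in> C" and ne: "C - {z} - A \<noteq> {}" for T C
    by (rule min_cut_uncross_nested[OF _ _ A C(1)]) (use z T remote unmixed[OF T C] C(2) ne in auto)
  have side: "\<exists>C. min_cut k T C \<and> z \<in> C" if T: "T \<subseteq> remote B" "\<not> robust k T" for T
  proof -
    obtain C where C: "min_cut k T C" using T(2) by (auto simp: not_robust_iff)
    moreover have "T \<subseteq> V" "z \<notin> T" using T(1) remote(2,3) by blast+
    ultimately have "min_cut k T (V - T - C)" "z \<in> C \<or> z \<in> V - T - C"
      using z by (auto intro: min_cut_compl)
    then show ?thesis using C by blast
  qed
  have good: "robust k {x}" if x: "x \<in> remote B" for x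
  proof (rule ccontr)
    have T: "{x} \<subseteq> remote B" using x by simp
    assume "\<not> robust k {x}"
    then obtain C where C: "min_cut k {x} C" "z \<in> C" using side[OF T] by blast
    obtain d where d: "d \<in> A" "d \<noteq> x" "d \<notin> C" using unmixed[OF T C] by blast
    have "C - {z} - A \<noteq> {}"
    proof
      assume *: "C - {z} - A = {}"
      have "card C < card A"
        by (rule card_exchange_less[OF finA, of "{x, d}" "{z}"])
          (use * d remote(1)[OF x] C(1) in \<open>auto simp: min_cut_def\<close>)
      then show False using A_least[OF remote(2)[OF x] C(1)] by simp
    qed
    from nested[OF T C this] have "card A \<le> card (A - {x} - C)"
      by (rule A_least[OF remote(2)[OF x]])
    moreover have "card (A - {x} - C) < card A"
      using finA remote(1)[OF x] by (intro psubset_card_mono) auto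
    ultimately show False by simp
  qed
  have unsplit: "\<exists>C. min_cut k {x, y} C \<and> \<not> split B C"
    if xy: "x \<in> remote B" "y \<in> remote B" "\<not> robust k {x, y}" for x y
  proof -
    have T: "{x, y} \<subseteq> remote B" using xy by simp
    obtain C where C: "min_cut k {x, y} C" "z \<in> C" using side[OF T xy(3)] by blast
    show ?thesis
    \<comment> \<open>Either \<open>C\<close> itself misses \<open>B\<close>, or its uncrossed
      replacement does.\<close>
    proof (cases "C - {z} - A = {}")
      case True
      then have "\<not> split B C" by (auto simp: split_def B_def)
      then show ?thesis using C by blast
    next
      case False
      have "\<not> split B (A - {x, y} - C)" by (auto simp: split_def B_def)
      then show ?thesis using nested[OF T C False] by blast
    qed
  qed
  have "\<exists>x\<in>A. \<exists>y\<in>A. {x, y} \<in> E \<and> (\<forall>b. {x, b} \<in> E \<or> {y, b} \<in> E \<longrightarrow> b \<in> A \<union> {z})"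
    using A_sub min_deg by (intro interior_edge[where m="k + 2"]) auto
  then obtain x y where xy: "x \<in> A" "y \<in> A" "{x, y} \<in> E"
    "\<And>b. {x, b} \<in> E \<Longrightarrow> b \<in> A \<union> {z}" "\<And>b. {y, b} \<in> E \<Longrightarrow> b \<in> A \<union> {z}" by blast
  then have "x \<in> remote B" "y \<in> remote B" using A_sub(2) unfolding remote_def B_def by blast+
  then show False
    using remote_core_impossible[of B x y] good unsplit xy(3) by (auto simp: B_def)
qed

end

theorem theorem3p1:
  fixes V :: "'a set" and E :: "'a set set" and k :: nat
  assumes "graph V E"
    and "k \<ge> 1"
    and "k_edge_connected V E k"
    and "min_degree_ge V E (k + 2)"
  shows "\<exists>u v. {u, v} \<in> E \<and>
           k_edge_connected (del_verts_V V {u, v}) (del_verts_E E {u, v}) k"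
proof (rule ccontr)
  assume none: "\<not> ?thesis"
  interpret fin_graph V E by standard (rule assms(1))
  have deg: "k + 2 \<le> degree E w" if "w \<in> V" for w
    using assms(4) that by (simp add: min_degree_ge_def)
  interpret edge_critical_graph V E k
  proof
    show "robust k {}" by (rule robust_if_k_edge_connected[OF assms(3)])
    show "k + 2 \<le> degree E w" if "w \<in> V" for w by (rule deg[OF that])
    show "\<not> robust k {u, v}" if "{u, v} \<in> E" for u v
    proof
      assume "robust k {u, v}"
      \<comment> \<open>The degree bound leaves at least \<open>k + 1 \<ge> 2\<close> vertices, so
        the convention for the trivial graph does not interfere.\<close>
      have "{b. {u, b} \<in> E} \<subseteq> insert v (V - {u, v})" using edge_ends by fastforce
      then have "card {b. {u, b} \<in> E} \<le> Suc (card (V - {u, v}))"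
        using finite_V card_mono[of "insert v (V - {u, v})"] by (simp add: card_insert_if)
      then have "2 \<le> card (V - {u, v})"
        using deg[OF edge_ends(1)[OF that]] assms(2) by (simp add: degree_eq_card_nbrs)
      then show False
        using none that k_edge_connected_deletion[OF \<open>robust k {u, v}\<close>] by blast
    qed
  qed
  have "V \<noteq> {}" using assms(3) by (simp add: k_edge_connected_def)
  then show False using all_robust_impossible non_robust_vertex_impossible by blast
qed

end
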